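(* Let $1\le p<\infty$ and let $\mathcal{F}$ be a commuting family of affine nonexpansive mappings from $\ell_p$ to itself. If there exists a nonempty bounded subset $B$ of $\ell_p$ such that $TB\subset B$ for all $T\in\mathcal{F}$, then $\mathcal{F}$ has a common fixed point in $\ell_p$: there exists $z\in\ell_p$ such that $Tz=z$ for all $T\in\mathcal{F}$.
   Context: $\ell_p$ is the Banach space of real sequences $x=(x_k)_{k\ge1}$ with $\|x\|_p=(\sum_{k\ge1}|x_k|^p)^{1/p}<\infty$. A mapping $T:\ell_p\to\ell_p$ is nonexpansive if $\|Tx-Ty\|_p\le\|x-y\|_p$ for all $x,y$. The family $\mathcal{F}$ is commuting if $TU=UT$ for all $T,U\in\mathcal{F}$. *)

theory Defs
  imports Complex_Main "HOL-Library.FuncSet"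
begin

(* Sequences are indexed from 0 rather than from 1. The exponent is real, hence powr;
   since 0 powr p = 0, zero entries contribute nothing to the sum. *)

definition lp :: "real \<Rightarrow> (nat \<Rightarrow> real) set" where
  "lp p = {x. summable (\<lambda>k. \<bar>x k\<bar> powr p)}"

definition lp_norm :: "real \<Rightarrow> (nat \<Rightarrow> real) \<Rightarrow> real" where
  "lp_norm p x = (\<Sum>k. \<bar>x k\<bar> powr p) powr (1 / p)"

(* A self-map of the space is a total function on sequences of which only the
   restriction to lp p is ever considered; the next three predicates are relativised
   accordingly. *)

definition lp_nonexpansive :: "real \<Rightarrow> ((nat \<Rightarrow> real) \<Rightarrow> (nat \<Rightarrow> real)) \<Rightarrow> bool" where
  "lp_nonexpansive p T \<longleftrightarrow>
     (\<forall>x\<in>lp p. \<forall>y\<in>lp p.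
        lp_norm p (\<lambda>k. T x k - T y k) \<le> lp_norm p (\<lambda>k. x k - y k))"

definition lp_affine :: "real \<Rightarrow> ((nat \<Rightarrow> real) \<Rightarrow> (nat \<Rightarrow> real)) \<Rightarrow> bool" where
  "lp_affine p T \<longleftrightarrow>
     (\<forall>x\<in>lp p. \<forall>y\<in>lp p. \<forall>t. 0 \<le> t \<and> t \<le> 1 \<longrightarrow>
        T (\<lambda>k. (1 - t) * x k + t * y k) = (\<lambda>k. (1 - t) * T x k + t * T y k))"

definition lp_commuting :: "real \<Rightarrow> ((nat \<Rightarrow> real) \<Rightarrow> (nat \<Rightarrow> real)) set \<Rightarrow> bool" where
  "lp_commuting p \<F> \<longleftrightarrow> (\<forall>T\<in>\<F>. \<forall>U\<in>\<F>. \<forall>x\<in>lp p. T (U x) = U (T x))"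

definition lp_bounded :: "real \<Rightarrow> (nat \<Rightarrow> real) set \<Rightarrow> bool" where
  "lp_bounded p B \<longleftrightarrow> (\<exists>M. \<forall>x\<in>B. lp_norm p x \<le> M)"

end

theory Submission imports Defs "HOL-Analysis.Analysis" begin

text \<open>
  The argument treats all exponents \<open>1 \<le> p < \<infinity>\<close> alike. In particular it covers \<open>p = 1\<close>, where the
  classical route (weak compactness of the closed convex hull of \<open>B\<close>, then Markov--Kakutani) breaks
  down: bounded sets of \<open>\<ell>\<^sub>1\<close> need not be relatively weakly compact, and although they are relatively
  compact for pointwise convergence, an affine nonexpansive map need not be continuous for it.

  Affinity and commutativity produce approximate fixed points. The convex hull of \<open>B\<close> is bounded and
  invariant. Replacing \<open>y\<close> by the Cesaro average of its orbit under \<open>U\<close> makes \<open>\<parallel>U y - y\<parallel>\<close> small, because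
  the sum telescopes, and it does not increase \<open>\<parallel>T y - y\<parallel>\<close> for maps \<open>T\<close> commuting with \<open>U\<close>. So
  finitely many maps are handled one after the other (\<open>approximate_common_fixed_point\<close>).

  Nonexpansiveness turns approximate fixed points into fixed points. The approximate fixed points
  for finite subfamilies form a bounded net, which by Tychonoff's theorem has a pointwise cluster
  point \<open>x\<close>, and \<open>x\<close> lies in \<open>\<ell>\<^sub>p\<close> by Fatou. In \<open>\<ell>\<^sub>p\<close> a bounded net \<open>y\<close> converging pointwise to \<open>x\<close>
  satisfies, for every \<open>u\<close>,
  \<open>\<parallel>y - u\<parallel>\<^sup>p - \<parallel>y - x\<parallel>\<^sup>p \<rightarrow> \<parallel>x - u\<parallel>\<^sup>p\<close>
  (the Brezis--Lieb identity; one half of it is \<open>brezis_lieb_ineq\<close>). Take \<open>u = T x\<close>: since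
  \<open>\<parallel>y - T x\<parallel> \<le> \<parallel>y - T y\<parallel> + \<parallel>y - x\<parallel>\<close> and the first summand tends to \<open>0\<close>, the left-hand side is
  asymptotically nonpositive, so \<open>T x = x\<close> (\<open>pointwise_limit_is_fixed\<close>).
\<close>

section \<open>The normed space of p-summable sequences\<close>

text \<open>Convexity up to and including the endpoint \<open>0\<close>, since sequences may have zero entries.\<close>

lemma powr_convex_nonneg:
  fixes a b t p :: real
  assumes "1 \<le> p" "0 \<le> a" "0 \<le> b" "0 \<le> t" "t \<le> 1"
  shows "((1 - t) * a + t * b) powr p \<le> (1 - t) * a powr p + t * b powr p"
proof -
  have scale: "(s * c) powr p \<le> s * c powr p" if "0 \<le> s" "s \<le> 1" "0 \<le> c" for s c :: real
  proof -
    have "s powr p \<le> s"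
      using powr_mono'[of 1 p s] that assms(1) by (cases "s = 0") auto
    then show ?thesis
      using that by (simp add: powr_mult mult_right_mono)
  qed
  show ?thesis
  proof (cases "a = 0 \<or> b = 0")
    case True
    then show ?thesis using scale[of t b] scale[of "1 - t" a] assms by auto
  next
    case False
    then show ?thesis
      using convex_onD[OF powr_convex[OF assms(1)], of t a b] assms by auto
  qed
qed

lemma lp_norm_nonneg: "0 \<le> lp_norm p x"
  by (simp add: lp_norm_def)

lemma lp_norm_powr:
  assumes "1 \<le> p" "x \<in> lp p"
  shows "lp_norm p x powr p = (\<Sum>k. \<bar>x k\<bar> powr p)"
  using assms by (simp add: lp_norm_def lp_def powr_powr suminf_nonneg)

lemma lp_norm_le_iff:
  assumes "1 \<le> p" "x \<in> lp p" "0 \<le> c"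
  shows "lp_norm p x \<le> c \<longleftrightarrow> (\<Sum>k. \<bar>x k\<bar> powr p) \<le> c powr p"
  unfolding lp_norm_powr[OF assms(1,2), symmetric]
  using assms powr_mono2[of p "lp_norm p x" c] powr_less_mono2[of p c "lp_norm p x"] lp_norm_nonneg[of p x]
  by (meson less_le_trans linorder_not_le order_less_irrefl powr_ge_zero zero_less_one less_imp_le)

text \<open>
  Minkowski's inequality, from convexity of the unit ball: for \<open>a > \<parallel>x\<parallel>\<close> and \<open>b > \<parallel>y\<parallel>\<close> the sequence
  \<open>(x + y) / (a + b)\<close> is a convex combination of \<open>x / a\<close> and \<open>y / b\<close>. Strict upper bounds instead of
  the norms themselves avoid dividing by a vanishing norm.
\<close>

lemma
  assumes p: "1 \<le> p" and x: "x \<in> lp p" and y: "y \<in> lp p"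
  shows lp_add: "(\<lambda>k. x k + y k) \<in> lp p"
    and lp_norm_triangle: "lp_norm p (\<lambda>k. x k + y k) \<le> lp_norm p x + lp_norm p y"
proof -
  have main: "(\<lambda>k. x k + y k) \<in> lp p \<and> lp_norm p (\<lambda>k. x k + y k) \<le> a + b"
    if a: "lp_norm p x < a" and b: "lp_norm p y < b" for a b
  proof -
    have pos: "0 < a" "0 < b" using a b lp_norm_nonneg[of p x] lp_norm_nonneg[of p y] by linarith+
    define t where "t = b / (a + b)"
    have t: "0 \<le> t" "t \<le> 1" "1 - t = a / (a + b)" using pos by (auto simp: t_def field_simps)
    define g where "g k = (a + b) powr p *
      ((1 - t) * (\<bar>x k\<bar> powr p / a powr p) + t * (\<bar>y k\<bar> powr p / b powr p))" for k
    have le: "\<bar>x k + y k\<bar> powr p \<le> g k" for k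
    proof -
      have "\<bar>x k + y k\<bar> \<le> \<bar>x k\<bar> + \<bar>y k\<bar>" by simp
      also have "\<dots> = (a + b) * ((1 - t) * (\<bar>x k\<bar> / a) + t * (\<bar>y k\<bar> / b))"
        unfolding t(3) unfolding t_def using pos by (simp add: divide_simps)
      finally have "\<bar>x k + y k\<bar> powr p \<le> \<dots> powr p"
        using p by (intro powr_mono2) auto
      also have "\<dots> = (a + b) powr p * ((1 - t) * (\<bar>x k\<bar> / a) + t * (\<bar>y k\<bar> / b)) powr p"
        using pos t by (subst powr_mult) auto
      also have "\<dots> \<le> (a + b) powr p * ((1 - t) * (\<bar>x k\<bar> / a) powr p + t * (\<bar>y k\<bar> / b) powr p)"
        using pos t(1,2) p by (intro mult_left_mono powr_convex_nonneg) auto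
      also have "\<dots> = g k"
        using pos by (simp add: g_def powr_divide)
      finally show ?thesis .
    qed
    have sx: "(\<lambda>k. \<bar>x k\<bar> powr p) sums (lp_norm p x powr p)"
      and sy: "(\<lambda>k. \<bar>y k\<bar> powr p) sums (lp_norm p y powr p)"
      using x y lp_norm_powr[OF p] by (auto simp: lp_def summable_sums)
    have sg: "g sums ((a + b) powr p *
      ((1 - t) * (lp_norm p x powr p / a powr p) + t * (lp_norm p y powr p / b powr p)))"
      unfolding g_def by (intro sums_mult sums_add sums_divide sx sy)
    have mem: "(\<lambda>k. x k + y k) \<in> lp p"
      unfolding lp_def mem_Collect_eq
      by (rule summable_comparison_test'[OF sums_summable[OF sg], of 0]) (use le in auto)
    have "(\<Sum>k. \<bar>x k + y k\<bar> powr p) \<le> suminf g"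
      using mem le sums_summable[OF sg] by (intro suminf_le) (auto simp: lp_def)
    also have "\<dots> \<le> (a + b) powr p * ((1 - t) * 1 + t * 1)"
      unfolding sums_unique[OF sg, symmetric]
      using a b pos t(1,2) p lp_norm_nonneg
      by (intro mult_left_mono add_mono) (auto simp: powr_mono2 less_imp_le)
    finally show ?thesis
      using mem lp_norm_le_iff[OF p mem, of "a + b"] pos by auto
  qed
  show "(\<lambda>k. x k + y k) \<in> lp p" using main[of "lp_norm p x + 1" "lp_norm p y + 1"] by simp
  show "lp_norm p (\<lambda>k. x k + y k) \<le> lp_norm p x + lp_norm p y"
  proof (rule field_le_epsilon)
    fix e :: real assume "0 < e"
    then show "lp_norm p (\<lambda>k. x k + y k) \<le> lp_norm p x + lp_norm p y + e"
      using main[of "lp_norm p x + e/2" "lp_norm p y + e/2"] by simp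
  qed
qed

lemma
  assumes p: "1 \<le> p" and x: "x \<in> lp p"
  shows lp_scale: "(\<lambda>k. c * x k) \<in> lp p"
    and lp_norm_scale: "lp_norm p (\<lambda>k. c * x k) = \<bar>c\<bar> * lp_norm p x"
proof -
  have eq: "\<bar>c * x k\<bar> powr p = \<bar>c\<bar> powr p * \<bar>x k\<bar> powr p" for k
    by (simp add: abs_mult powr_mult)
  have s: "summable (\<lambda>k. \<bar>x k\<bar> powr p)" using x by (simp add: lp_def)
  show "(\<lambda>k. c * x k) \<in> lp p"
    using s unfolding lp_def mem_Collect_eq eq by (rule summable_mult)
  show "lp_norm p (\<lambda>k. c * x k) = \<bar>c\<bar> * lp_norm p x"
    using p s unfolding lp_norm_def eq
    by (simp add: suminf_mult powr_mult suminf_nonneg powr_powr)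
qed

lemma lp_norm_minus_commute: "lp_norm p (\<lambda>k. x k - y k) = lp_norm p (\<lambda>k. y k - x k)"
  by (simp add: lp_norm_def abs_minus_commute)

lemma
  assumes p: "1 \<le> p" and x: "x \<in> lp p" and y: "y \<in> lp p"
  shows lp_diff: "(\<lambda>k. x k - y k) \<in> lp p"
    and lp_norm_diff_le: "lp_norm p (\<lambda>k. x k - y k) \<le> lp_norm p x + lp_norm p y"
  using lp_add[OF p x lp_scale[OF p y, of "-1"]] lp_norm_triangle[OF p x lp_scale[OF p y, of "-1"]]
    lp_norm_scale[OF p y, of "-1"] by simp_all

lemma lp_norm_triangle_diff:
  assumes p: "1 \<le> p" and "x \<in> lp p" "y \<in> lp p" "z \<in> lp p"
  shows "lp_norm p (\<lambda>k. x k - z k) \<le> lp_norm p (\<lambda>k. x k - y k) + lp_norm p (\<lambda>k. y k - z k)"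
  using lp_norm_triangle[OF p lp_diff[OF p assms(2,3)] lp_diff[OF p assms(3,4)]] by simp

lemma
  assumes p: "1 \<le> p" and x: "x \<in> lp p" and y: "y \<in> lp p" and t: "0 \<le> t" "t \<le> 1"
  shows lp_convex_comb: "(\<lambda>k. (1 - t) * x k + t * y k) \<in> lp p"
    and lp_norm_convex_comb_le:
      "lp_norm p x \<le> M \<Longrightarrow> lp_norm p y \<le> M \<Longrightarrow> lp_norm p (\<lambda>k. (1 - t) * x k + t * y k) \<le> M"
proof -
  note m = lp_scale[OF p x, of "1 - t"] lp_scale[OF p y, of t]
  show "(\<lambda>k. (1 - t) * x k + t * y k) \<in> lp p" by (rule lp_add[OF p m])
  assume "lp_norm p x \<le> M" "lp_norm p y \<le> M"
  then have "(1 - t) * lp_norm p x + t * lp_norm p y \<le> M"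
    using t by (intro convex_bound_le) auto
  then show "lp_norm p (\<lambda>k. (1 - t) * x k + t * y k) \<le> M"
    using lp_norm_triangle[OF p m] t by (simp add: lp_norm_scale[OF p] x y)
qed

section \<open>The convex hull of an invariant set\<close>

text \<open>
  Convex hull for the pointwise operations. The inductive form makes an invariant of \<open>B\<close> that is
  stable under convex combinations pass to the hull by rule induction.
\<close>

inductive_set seq_hull :: "(nat \<Rightarrow> real) set \<Rightarrow> (nat \<Rightarrow> real) set" for B where
  base: "x \<in> B \<Longrightarrow> x \<in> seq_hull B"
| comb: "x \<in> seq_hull B \<Longrightarrow> y \<in> seq_hull B \<Longrightarrow> 0 \<le> t \<Longrightarrow> t \<le> 1 \<Longrightarrow>
    (\<lambda>k. (1 - t) * x k + t * y k) \<in> seq_hull B"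

lemma seq_hull_lp_bounded:
  assumes "1 \<le> p" "B \<subseteq> lp p" "\<And>x. x \<in> B \<Longrightarrow> lp_norm p x \<le> M" "x \<in> seq_hull B"
  shows "x \<in> lp p \<and> lp_norm p x \<le> M"
  using assms(4)
  by induction (use assms in \<open>auto intro: lp_convex_comb lp_norm_convex_comb_le\<close>)

lemma seq_hull_invariant:
  assumes "1 \<le> p" "B \<subseteq> lp p" "lp_affine p T" "T ` B \<subseteq> B" "x \<in> seq_hull B"
  shows "T x \<in> seq_hull B"
proof -
  have "x \<in> lp p \<and> T x \<in> seq_hull B"
    using assms(5)
  proof induction
    case (comb x y t)
    then have "T (\<lambda>k. (1 - t) * x k + t * y k) = (\<lambda>k. (1 - t) * T x k + t * T y k)"
      using assms(3) by (auto simp: lp_affine_def)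
    with comb show ?case
      by (auto intro: lp_convex_comb[OF assms(1)] seq_hull.comb)
  qed (use assms in \<open>auto intro: seq_hull.base\<close>)
  then show ?thesis ..
qed

section \<open>Approximate common fixed points\<close>

text \<open>
  The witness is the average \<open>a\<^sub>n\<close> of \<open>y, U y, \<dots>, U\<^sup>n y\<close>, built by the recursion
  \<open>a\<^sub>n\<^sub>+\<^sub>1 = (1 - t) a\<^sub>n + t U\<^sup>n\<^sup>+\<^sup>1 y\<close> with \<open>t = 1 / (n + 2)\<close>, so that each step
  is a convex combination of two points. The defect \<open>U a\<^sub>n - a\<^sub>n\<close> telescopes. For \<open>T\<close> commuting with \<open>U\<close>, the difference \<open>T a\<^sub>n - a\<^sub>n\<close>
  is the average of \<open>U\<^sup>i (T y) - U\<^sup>i y\<close>, each of norm at most \<open>\<parallel>T y - y\<parallel>\<close>.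
\<close>

lemma cesaro_almost_fixed:
  assumes p: "1 \<le> p"
    and C: "C \<subseteq> lp p"
    and conv: "\<And>x y t. x \<in> C \<Longrightarrow> y \<in> C \<Longrightarrow> 0 \<le> t \<Longrightarrow> t \<le> 1 \<Longrightarrow>
      (\<lambda>k. (1 - t) * x k + t * y k) \<in> C"
    and aff: "\<And>T. T \<in> insert U S \<Longrightarrow> lp_affine p T"
    and inv: "\<And>T x. T \<in> insert U S \<Longrightarrow> x \<in> C \<Longrightarrow> T x \<in> C"
    and ne: "lp_nonexpansive p U"
    and comm: "\<And>T x. T \<in> S \<Longrightarrow> x \<in> C \<Longrightarrow> T (U x) = U (T x)"
    and y: "y \<in> C" "\<And>T. T \<in> S \<Longrightarrow> lp_norm p (\<lambda>k. T y k - y k) \<le> e"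
  shows "\<exists>a\<in>C. (\<forall>k. U a k - a k = ((U ^^ Suc n) y k - y k) / real (Suc n)) \<and>
    (\<forall>T\<in>S. lp_norm p (\<lambda>k. T a k - a k) \<le> e)"
proof (induction n)
  case 0
  then show ?case using y by (intro bexI[of _ y]) auto
next
  case (Suc n)
  then obtain a where a: "a \<in> C" "\<And>k. U a k - a k = ((U ^^ Suc n) y k - y k) / real (Suc n)"
    "\<And>T. T \<in> S \<Longrightarrow> lp_norm p (\<lambda>k. T a k - a k) \<le> e" by blast
  have iter: "(U ^^ m) x \<in> C" if "x \<in> C" for m x
    using that inv by (induction m) auto
  have Titer: "T ((U ^^ m) x) = (U ^^ m) (T x)" if "x \<in> C" "T \<in> S" for m x T
    using that by (induction m) (auto simp: comm iter)
  have neiter: "lp_norm p (\<lambda>k. (U ^^ m) x k - (U ^^ m) z k) \<le> lp_norm p (\<lambda>k. x k - z k)"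
    if "x \<in> C" "z \<in> C" for m x z
  proof (induction m)
    case (Suc m)
    have "lp_norm p (\<lambda>k. (U ^^ Suc m) x k - (U ^^ Suc m) z k) \<le> lp_norm p (\<lambda>k. (U ^^ m) x k - (U ^^ m) z k)"
      using ne C iter[OF that(1), of m] iter[OF that(2), of m] unfolding lp_nonexpansive_def by auto
    with Suc show ?case by linarith
  qed simp
  define t where "t = 1 / real (Suc (Suc n))"
  have t: "0 \<le> t" "t \<le> 1" "(1 - t) / real (Suc n) = t"
    by (simp_all add: t_def divide_simps)
  let ?b = "(U ^^ Suc n) y"
  define c where "c = (\<lambda>k. (1 - t) * a k + t * ?b k)"
  have bC: "?b \<in> C" using iter y by blast
  have Tc: "T c = (\<lambda>k. (1 - t) * T a k + t * T ?b k)" if "T \<in> insert U S" for T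
    using aff[OF that] C a(1) bC t unfolding c_def lp_affine_def by blast
  \<comment> \<open>Since \<open>(1 - t) / (n + 1) = t\<close>, both defects get the same weight and their sum telescopes.\<close>
  have "U c k - c k = ((U ^^ Suc (Suc n)) y k - y k) / real (Suc (Suc n))" for k
  proof -
    have "U c k - c k = (1 - t) * (U a k - a k) + t * (U ?b k - ?b k)"
      using Tc[of U] by (simp add: c_def algebra_simps)
    also have "(1 - t) * (U a k - a k) = (1 - t) / real (Suc n) * (?b k - y k)"
      unfolding a(2) by simp
    also have "\<dots> = t * (?b k - y k)" unfolding t(3) ..
    finally have "U c k - c k = t * (U ?b k - y k)" by (simp add: algebra_simps)
    then show ?thesis by (simp add: t_def)
  qed
  moreover have "lp_norm p (\<lambda>k. T c k - c k) \<le> e" if T: "T \<in> S" for T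
  proof -
    have TyC: "T y \<in> C" "T a \<in> C" "T ?b \<in> C" using inv T y(1) a(1) bC by auto
    have "lp_norm p (\<lambda>k. T ?b k - ?b k) \<le> e"
      unfolding Titer[OF y(1) T] using neiter[OF TyC(1) y(1), of "Suc n"] y(2)[OF T] by linarith
    then have "lp_norm p (\<lambda>k. (1 - t) * (T a k - a k) + t * (T ?b k - ?b k)) \<le> e"
      using C TyC a(1) bC t a(3)[OF T] by (intro lp_norm_convex_comb_le p lp_diff) auto
    moreover have "(\<lambda>k. T c k - c k) = (\<lambda>k. (1 - t) * (T a k - a k) + t * (T ?b k - ?b k))"
      using Tc[of T] T by (simp add: c_def algebra_simps)
    ultimately show ?thesis by simp
  qed
  moreover have "c \<in> C" unfolding c_def using a(1) bC t by (intro conv)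
  ultimately show ?case by blast
qed

text \<open>
  Induction on the finite family: averaging over the orbit of the new map keeps the old defects at
  most \<open>e\<close>, and long averages make the new defect at most \<open>2 M / (n + 1)\<close>.
\<close>

lemma approximate_common_fixed_point:
  assumes p: "1 \<le> p"
    and C: "C \<subseteq> lp p" "C \<noteq> {}" "\<And>x. x \<in> C \<Longrightarrow> lp_norm p x \<le> M"
    and conv: "\<And>x y t. x \<in> C \<Longrightarrow> y \<in> C \<Longrightarrow> 0 \<le> t \<Longrightarrow> t \<le> 1 \<Longrightarrow>
      (\<lambda>k. (1 - t) * x k + t * y k) \<in> C"
    and "finite S"
    and "\<And>T. T \<in> S \<Longrightarrow> lp_affine p T" "\<And>T x. T \<in> S \<Longrightarrow> x \<in> C \<Longrightarrow> T x \<in> C"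
      "\<And>T. T \<in> S \<Longrightarrow> lp_nonexpansive p T"
      "\<And>T U x. T \<in> S \<Longrightarrow> U \<in> S \<Longrightarrow> x \<in> C \<Longrightarrow> T (U x) = U (T x)"
    and e: "0 < e"
  shows "\<exists>y\<in>C. \<forall>T\<in>S. lp_norm p (\<lambda>k. T y k - y k) \<le> e"
  using assms(6-10)
proof (induction S rule: finite_induct)
  case empty
  then show ?case using C by auto
next
  case (insert U S)
  then obtain y where y: "y \<in> C" "\<And>T. T \<in> S \<Longrightarrow> lp_norm p (\<lambda>k. T y k - y k) \<le> e" by auto
  obtain n where n: "2 * M / e < real n" using reals_Archimedean2 by blast
  have "\<exists>a\<in>C. (\<forall>k. U a k - a k = ((U ^^ Suc n) y k - y k) / real (Suc n)) \<and>
      (\<forall>T\<in>S. lp_norm p (\<lambda>k. T a k - a k) \<le> e)"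
  proof (rule cesaro_almost_fixed[OF p C(1)])
    show "T (U x) = U (T x)" if "T \<in> S" "x \<in> C" for T x
      using that by (intro insert.prems(4)) auto
    show "lp_nonexpansive p U" by (intro insert.prems(3)) simp
  qed (fact conv insert.prems(1,2) y)+
  then obtain a where a: "a \<in> C" "\<And>k. U a k - a k = ((U ^^ Suc n) y k - y k) / real (Suc n)"
    "\<And>T. T \<in> S \<Longrightarrow> lp_norm p (\<lambda>k. T a k - a k) \<le> e"
    by blast
  have "(U ^^ m) y \<in> C" for m
    using insert.prems(2)[of U] y(1) by (induction m) auto
  then have b: "(U ^^ Suc n) y \<in> C" .
  let ?d = "\<lambda>k. (U ^^ Suc n) y k - y k"
  have d: "?d \<in> lp p" using lp_diff[OF p] b y(1) C(1) by blast
  have "lp_norm p (\<lambda>k. U a k - a k) = lp_norm p (\<lambda>k. (1 / real (Suc n)) * ?d k)"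
    unfolding a(2) by simp
  also have "\<dots> = lp_norm p ?d / real (Suc n)"
    by (subst lp_norm_scale[OF p d]) simp
  also have "\<dots> \<le> (M + M) / real (Suc n)"
    using lp_norm_diff_le[OF p subsetD[OF C(1) b] subsetD[OF C(1) y(1)]] C(3)[OF b] C(3)[OF y(1)]
    by (intro divide_right_mono) linarith+
  also have "\<dots> \<le> e"
    using n e by (simp add: field_simps)
  finally have "lp_norm p (\<lambda>k. U a k - a k) \<le> e" .
  with a(1,3) show ?case by blast
qed

section \<open>Norms along bounded pointwise convergent nets\<close>

lemma lp_shift: "x \<in> lp p \<Longrightarrow> (\<lambda>k. x (k + N)) \<in> lp p"
  by (simp add: lp_def summable_iff_shift[of "\<lambda>k. \<bar>x k\<bar> powr p" N])

lemma lp_norm_powr_split: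
  assumes "1 \<le> p" "x \<in> lp p"
  shows "lp_norm p x powr p = (\<Sum>k<N. \<bar>x k\<bar> powr p) + lp_norm p (\<lambda>k. x (k + N)) powr p"
  unfolding lp_norm_powr[OF assms] lp_norm_powr[OF assms(1) lp_shift[OF assms(2)]]
  using assms(2) suminf_split_initial_segment[of "\<lambda>k. \<bar>x k\<bar> powr p" N] by (simp add: lp_def)

text \<open>
  Uniform continuity on bounded sets in one-sided form. A bound on \<open>a\<close> follows, as
  it exceeds \<open>b \<le> K\<close> by at most \<open>d \<le> 1\<close>; hence the interval \<open>{0..K + 1}\<close> in the proof.
\<close>

lemma powr_uniformly_continuous:
  fixes p K e :: real
  assumes "1 \<le> p" "0 < e"
  obtains d where "0 < d" "\<And>a b. 0 \<le> a \<Longrightarrow> b \<le> K \<Longrightarrow> a \<le> b + d \<Longrightarrow> 0 \<le> b \<Longrightarrow> a powr p \<le> b powr p + e"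
proof -
  have "continuous_on {0..K+1} (\<lambda>x::real. x powr p)"
    using assms by (intro continuous_on_powr' continuous_intros) auto
  then have "uniformly_continuous_on {0..K+1} (\<lambda>x::real. x powr p)"
    by (intro compact_uniformly_continuous) auto
  then obtain d where d: "0 < d" "\<And>a b. a \<in> {0..K+1} \<Longrightarrow> b \<in> {0..K+1} \<Longrightarrow> dist a b < d \<Longrightarrow>
      dist (a powr p) (b powr p) < e"
    using assms(2) unfolding uniformly_continuous_on_def by metis
  show ?thesis
  proof (rule that[of "min (d/2) 1"])
    show "0 < min (d/2) 1" using d by simp
    fix a b assume ab: "0 \<le> a" "b \<le> K" "a \<le> b + min (d/2) 1" "0 \<le> b"
    show "a powr p \<le> b powr p + e"
    proof (cases "a \<le> b")
      case True
      then have "a powr p \<le> b powr p" using ab assms by (intro powr_mono2) auto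
      then show ?thesis using assms by simp
    next
      case False
      then have "dist (a powr p) (b powr p) < e"
        using ab d(1) by (intro d(2)) (auto simp: dist_real_def)
      then show ?thesis by (auto simp: dist_real_def)
    qed
  qed
qed

lemma lp_norm_shift_tendsto_0:
  assumes p: "1 \<le> p" and x: "x \<in> lp p"
  shows "(\<lambda>N. lp_norm p (\<lambda>k. x (k + N))) \<longlonglongrightarrow> 0"
proof -
  have "(\<lambda>N. \<Sum>k. \<bar>x (k + N)\<bar> powr p) \<longlonglongrightarrow> 0"
    using suminf_exist_split2[of "\<lambda>k. \<bar>x k\<bar> powr p"] x by (simp add: lp_def)
  then have "(\<lambda>N. (\<Sum>k. \<bar>x (k + N)\<bar> powr p) powr (1 / p)) \<longlonglongrightarrow> 0 powr (1 / p)"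
    using p x lp_shift[OF x] by (intro tendsto_powr') (auto simp: lp_def intro!: always_eventually suminf_nonneg)
  then show ?thesis by (simp add: lp_norm_def)
qed

text \<open>
  Asymptotically, \<open>v\<close> and \<open>w\<close> behave as if they had disjoint supports. Cut at an index \<open>N\<close> beyond
  which \<open>w\<close> is negligible: on the finite head \<open>v\<close> tends to \<open>0\<close>, so only \<open>w\<close> contributes, and on the
  tail \<open>v\<close> and \<open>v + w\<close> differ by the small tail of \<open>w\<close>.
\<close>

lemma brezis_lieb_ineq:
  assumes p: "1 \<le> p" and w: "w \<in> lp p"
    and v: "\<forall>\<^sub>F i in G. v i \<in> lp p \<and> lp_norm p (v i) \<le> K"
    and lim: "\<And>k. ((\<lambda>i. v i k) \<longlongrightarrow> 0) G"
    and e: "0 < e"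
  shows "\<forall>\<^sub>F i in G. lp_norm p w powr p + lp_norm p (v i) powr p \<le> lp_norm p (\<lambda>k. v i k + w k) powr p + e"
proof -
  \<comment> \<open>\<open>L\<close> bounds the norm of \<open>v i + w\<close>. The error \<open>e\<close> is split into four: the two heads, the tail of
    \<open>w\<close>, and the change of the tail of \<open>v i\<close> when \<open>w\<close> is added.\<close>
  define L where "L = K + lp_norm p w"
  obtain d where d: "0 < d" and
    dd: "\<And>a b. 0 \<le> a \<Longrightarrow> b \<le> L \<Longrightarrow> a \<le> b + d \<Longrightarrow> 0 \<le> b \<Longrightarrow> a powr p \<le> b powr p + e / 4"
    using powr_uniformly_continuous[OF p, of "e/4" L] e by auto
  note tail = lp_norm_shift_tendsto_0[OF p w]
  have "(\<lambda>N. lp_norm p (\<lambda>k. w (k + N)) powr p) \<longlonglongrightarrow> 0 powr p"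
    using tail p by (intro tendsto_powr') (auto intro!: always_eventually simp: lp_norm_nonneg)
  then have "\<forall>\<^sub>F N in sequentially. lp_norm p (\<lambda>k. w (k + N)) powr p < e / 4"
    using e by (intro order_tendstoD) auto
  moreover have "\<forall>\<^sub>F N in sequentially. lp_norm p (\<lambda>k. w (k + N)) < d"
    using tail d by (intro order_tendstoD) auto
  ultimately obtain N where N: "lp_norm p (\<lambda>k. w (k + N)) < d" "lp_norm p (\<lambda>k. w (k + N)) powr p < e / 4"
    by (metis (mono_tags, lifting) eventually_conj eventually_happens' sequentially_bot)
  have "((\<lambda>i. \<Sum>k<N. \<bar>v i k\<bar> powr p) \<longlongrightarrow> (\<Sum>k<N. \<bar>0\<bar> powr p)) G"
    using p by (intro tendsto_sum tendsto_powr' tendsto_rabs lim) auto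
  then have 1: "\<forall>\<^sub>F i in G. (\<Sum>k<N. \<bar>v i k\<bar> powr p) < e / 4"
    using e by (intro order_tendstoD) auto
  have "((\<lambda>i. \<Sum>k<N. \<bar>v i k + w k\<bar> powr p) \<longlongrightarrow> (\<Sum>k<N. \<bar>0 + w k\<bar> powr p)) G"
    using p by (intro tendsto_sum tendsto_powr' tendsto_rabs tendsto_add lim tendsto_const) auto
  then have 2: "\<forall>\<^sub>F i in G. (\<Sum>k<N. \<bar>w k\<bar> powr p) - e / 4 < (\<Sum>k<N. \<bar>v i k + w k\<bar> powr p)"
    using e by (intro order_tendstoD) auto
  show ?thesis
    using v 1 2
  proof eventually_elim
    case (elim i)
    then have vi: "v i \<in> lp p" and K: "lp_norm p (v i) \<le> K" by auto
    let ?sv = "\<lambda>k. v i (k + N)" and ?sw = "\<lambda>k. w (k + N)"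
    let ?s = "\<lambda>k. v i (k + N) + w (k + N)"
    have u: "(\<lambda>k. v i k + w k) \<in> lp p" by (rule lp_add[OF p vi w])
    have sm: "?sv \<in> lp p" "?sw \<in> lp p" "?s \<in> lp p"
      using lp_shift[OF vi] lp_shift[OF w] lp_shift[OF u] by auto
    have "lp_norm p ?sv \<le> lp_norm p ?s + lp_norm p ?sw"
      using lp_norm_diff_le[OF p sm(3,2)] by simp
    moreover have "lp_norm p ?s \<le> L"
    proof -
      have "lp_norm p ?s powr p \<le> lp_norm p (\<lambda>k. v i k + w k) powr p"
        unfolding lp_norm_powr_split[OF p u, of N] by (simp add: sum_nonneg)
      then have "lp_norm p ?s \<le> lp_norm p (\<lambda>k. v i k + w k)"
        using lp_norm_le_iff[OF p sm(3) lp_norm_nonneg] lp_norm_powr[OF p sm(3)] by simp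
      then show ?thesis using lp_norm_triangle[OF p vi w] K by (simp add: L_def)
    qed
    ultimately have "lp_norm p ?sv powr p \<le> lp_norm p ?s powr p + e / 4"
      using N(1) by (intro dd lp_norm_nonneg) auto
    then show ?case
      using elim N(2) unfolding lp_norm_powr_split[OF p u, of N] lp_norm_powr_split[OF p vi, of N]
        lp_norm_powr_split[OF p w, of N] by argo
  qed
qed

lemma lp_fatou:
  assumes p: "1 \<le> p" and G: "G \<noteq> bot"
    and y: "\<forall>\<^sub>F y in G. y \<in> lp p \<and> lp_norm p y \<le> M"
    and lim: "\<And>k. ((\<lambda>y. y k) \<longlongrightarrow> x k) G"
  shows "x \<in> lp p"
proof -
  have "(\<Sum>k<N. \<bar>x k\<bar> powr p) \<le> M powr p" for N
  proof (rule tendsto_upperbound[OF _ _ G])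
    show "((\<lambda>y. \<Sum>k<N. \<bar>y k\<bar> powr p) \<longlongrightarrow> (\<Sum>k<N. \<bar>x k\<bar> powr p)) G"
      using p by (intro tendsto_sum tendsto_powr' tendsto_rabs lim tendsto_const) auto
    show "\<forall>\<^sub>F y in G. (\<Sum>k<N. \<bar>y k\<bar> powr p) \<le> M powr p"
      using y
    proof eventually_elim
      case (elim y)
      then have "lp_norm p y powr p \<le> M powr p"
        using p lp_norm_nonneg by (intro powr_mono2) auto
      then show ?case
        using lp_norm_powr_split[OF p, of y N] elim powr_ge_zero[of "lp_norm p (\<lambda>k. y (k + N))" p] by linarith
    qed
  qed
  from this[of "Suc _"] show ?thesis
    unfolding lp_def mem_Collect_eq lessThan_Suc_atMost
    by (intro bounded_imp_summable[of _ "M powr p"]) auto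
qed

section \<open>Pointwise limits of approximate fixed points\<close>

lemma lp_eq_if_norm_diff_le_0:
  assumes "1 \<le> p" "x \<in> lp p" "y \<in> lp p" "lp_norm p (\<lambda>k. x k - y k) powr p \<le> 0"
  shows "x = y"
proof -
  have d: "(\<lambda>k. x k - y k) \<in> lp p" using assms lp_diff by blast
  then have s: "summable (\<lambda>k. \<bar>x k - y k\<bar> powr p)" by (simp add: lp_def)
  have "(\<Sum>k. \<bar>x k - y k\<bar> powr p) = 0"
    using assms(4) powr_ge_zero[of "lp_norm p (\<lambda>k. x k - y k)" p] unfolding lp_norm_powr[OF assms(1) d, symmetric] by linarith
  then have "\<bar>x k - y k\<bar> powr p = 0" for k
    using suminf_eq_zero_iff[OF s] by auto
  then show ?thesis by auto
qed

text \<open>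
  By nonexpansiveness \<open>\<parallel>y - T x\<parallel>\<close> asymptotically does not exceed \<open>\<parallel>y - x\<parallel>\<close>, whereas by
  \<open>brezis_lieb_ineq\<close> its \<open>p\<close>-th power exceeds that of \<open>\<parallel>y - x\<parallel>\<close> by at least \<open>\<parallel>x - T x\<parallel>\<^sup>p\<close> in the
  limit.
\<close>

lemma pointwise_limit_is_fixed:
  assumes p: "1 \<le> p" and G: "G \<noteq> bot"
    and T: "T \<in> lp p \<rightarrow> lp p" "lp_nonexpansive p T"
    and y: "\<forall>\<^sub>F y in G. y \<in> lp p \<and> lp_norm p y \<le> M"
    and lim: "\<And>k. ((\<lambda>y. y k) \<longlongrightarrow> x k) G"
    and almost: "((\<lambda>y. lp_norm p (\<lambda>k. T y k - y k)) \<longlongrightarrow> 0) G"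
  shows "T x = x"
proof -
  have x: "x \<in> lp p" by (rule lp_fatou[OF p G y lim])
  with T have Tx: "T x \<in> lp p" by auto
  let ?w = "\<lambda>k. x k - T x k"
  define K where "K = M + lp_norm p x"
  have "lp_norm p ?w powr p \<le> 0"
  proof (rule field_le_epsilon)
    fix e :: real assume e: "0 < e"
    obtain d where d: "0 < d" and
      dd: "\<And>a b. 0 \<le> a \<Longrightarrow> b \<le> K \<Longrightarrow> a \<le> b + d \<Longrightarrow> 0 \<le> b \<Longrightarrow> a powr p \<le> b powr p + e / 2"
      using powr_uniformly_continuous[OF p, of "e/2" K] e by auto
    have bd: "\<forall>\<^sub>F y in G. (\<lambda>k. y k - x k) \<in> lp p \<and> lp_norm p (\<lambda>k. y k - x k) \<le> K"
      using y
    proof eventually_elim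
      case (elim y)
      then show ?case using lp_diff[OF p _ x, of y] lp_norm_diff_le[OF p _ x, of y] by (auto simp: K_def)
    qed
    have "\<And>k. ((\<lambda>y. y k - x k) \<longlongrightarrow> 0) G" using lim by (simp add: LIM_zero)
    then have bl: "\<forall>\<^sub>F y in G. lp_norm p ?w powr p + lp_norm p (\<lambda>k. y k - x k) powr p
      \<le> lp_norm p (\<lambda>k. (y k - x k) + ?w k) powr p + e / 2"
      using e by (intro brezis_lieb_ineq[OF p lp_diff[OF p x Tx] bd]) auto
    have "\<forall>\<^sub>F y in G. lp_norm p (\<lambda>k. T y k - y k) < d"
      using almost d by (intro order_tendstoD) auto
    with y bd bl have "\<forall>\<^sub>F y in G. lp_norm p ?w powr p \<le> 0 + e"
    proof eventually_elim
      case (elim y)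
      then have yl: "y \<in> lp p" and Ty: "T y \<in> lp p" using T by auto
      have "lp_norm p (\<lambda>k. y k - T x k) \<le> lp_norm p (\<lambda>k. y k - T y k) + lp_norm p (\<lambda>k. T y k - T x k)"
        by (rule lp_norm_triangle_diff[OF p yl Ty Tx])
      also have "lp_norm p (\<lambda>k. y k - T y k) = lp_norm p (\<lambda>k. T y k - y k)"
        by (rule lp_norm_minus_commute)
      finally have "lp_norm p (\<lambda>k. y k - T x k) \<le> lp_norm p (\<lambda>k. y k - x k) + d"
        using T(2) yl x elim unfolding lp_nonexpansive_def by fastforce
      then have "lp_norm p (\<lambda>k. y k - T x k) powr p \<le> lp_norm p (\<lambda>k. y k - x k) powr p + e / 2"
        using elim by (intro dd lp_norm_nonneg) auto
      then show ?case using elim by auto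
    qed
    then show "lp_norm p ?w powr p \<le> 0 + e"
      using G by (simp add: eventually_const)
  qed
  then show ?thesis using lp_eq_if_norm_diff_le_0[OF p x Tx] by simp
qed

text \<open>
  Tychonoff's theorem, in filter form: a refinement of the filter converges in every coordinate.
  Filters rather than subsequences are used because the net below is indexed by finite subsets of a
  possibly uncountable family.
\<close>

lemma bounded_filter_pointwise_cluster:
  fixes F :: "('a \<Rightarrow> real) filter"
  assumes "F \<noteq> bot" "\<forall>\<^sub>F y in F. \<forall>k. \<bar>y k\<bar> \<le> M"
  obtains G x where "G \<noteq> bot" "G \<le> F" "\<And>k. ((\<lambda>y. y k) \<longlongrightarrow> x k) G"
proof -
  have "compactin (product_topology (\<lambda>_. euclidean) UNIV) (PiE UNIV (\<lambda>_::'a. {-M..M}))"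
    by (subst compactin_PiE) auto
  then have cpt: "compact (PiE UNIV (\<lambda>_::'a. {-M..M}))"
    by (simp add: euclidean_product_topology)
  have "\<forall>\<^sub>F y in F. y \<in> PiE UNIV (\<lambda>_::'a. {-M..M})"
    using assms(2) by eventually_elim (auto simp: abs_le_iff minus_le_iff)
  then obtain x where x: "inf (nhds x) F \<noteq> bot"
    using cpt assms(1) unfolding compact_filter by blast
  show ?thesis
  proof (rule that[OF x])
    show "inf (nhds x) F \<le> F" by simp
    fix k
    have "((\<lambda>y::'a \<Rightarrow> real. y k) \<longlongrightarrow> x k) (nhds x)"
    proof -
      have "continuous_on UNIV (\<lambda>y::'a \<Rightarrow> real. y k)" by simp
      then show ?thesis
        using tendsto_at_iff_tendsto_nhds[of "\<lambda>y. y k" x] by (simp add: continuous_on_def)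
    qed
    then show "((\<lambda>y. y k) \<longlongrightarrow> x k) (inf (nhds x) F)"
      by (rule tendsto_mono[rotated]) simp
  qed
qed

lemma lp_abs_le_norm:
  assumes p: "1 \<le> p" and x: "x \<in> lp p"
  shows "\<bar>x k\<bar> \<le> lp_norm p x"
proof -
  have "\<bar>x k\<bar> powr p \<le> lp_norm p x powr p"
    unfolding lp_norm_powr[OF assms] using x sum_le_suminf[of "\<lambda>k. \<bar>x k\<bar> powr p" "{k}"] by (simp add: lp_def)
  then show ?thesis
    using p powr_less_mono2[of p "lp_norm p x" "\<bar>x k\<bar>"] lp_norm_nonneg[of p x] by force
qed

section \<open>The common fixed point\<close>

theorem corollary3p4:
  fixes p :: real
    and \<F> :: "((nat \<Rightarrow> real) \<Rightarrow> (nat \<Rightarrow> real)) set"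
  assumes "1 \<le> p"
    and "\<And>T. T \<in> \<F> \<Longrightarrow> T \<in> lp p \<rightarrow> lp p"
    and "\<And>T. T \<in> \<F> \<Longrightarrow> lp_affine p T"
    and "\<And>T. T \<in> \<F> \<Longrightarrow> lp_nonexpansive p T"
    and "lp_commuting p \<F>"
    and "\<exists>B. B \<noteq> {} \<and> B \<subseteq> lp p \<and> lp_bounded p B \<and> (\<forall>T\<in>\<F>. T ` B \<subseteq> B)"
  shows "\<exists>z\<in>lp p. \<forall>T\<in>\<F>. T z = z"
proof -
  note p = assms(1)
  obtain B where B': "B \<noteq> {} \<and> B \<subseteq> lp p \<and> lp_bounded p B \<and> (\<forall>T\<in>\<F>. T ` B \<subseteq> B)"
    using assms(6) ..
  then obtain M where "\<forall>x\<in>B. lp_norm p x \<le> M" by (auto simp: lp_bounded_def)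
  with B' have B: "B \<noteq> {}" "B \<subseteq> lp p" "\<And>x. x \<in> B \<Longrightarrow> lp_norm p x \<le> M"
    "\<And>T. T \<in> \<F> \<Longrightarrow> T ` B \<subseteq> B" by simp_all
  define C where "C = seq_hull B"
  have C: "C \<subseteq> lp p" "C \<noteq> {}" "\<And>x. x \<in> C \<Longrightarrow> lp_norm p x \<le> M"
    using seq_hull_lp_bounded[OF p B(2,3)] B(1) by (auto simp: C_def intro: seq_hull.base)
  have inv: "T x \<in> C" if "T \<in> \<F>" "x \<in> C" for T x
    using seq_hull_invariant[OF p B(2) assms(3) B(4)] that by (simp add: C_def)
  \<comment> \<open>Pairing each map with an accuracy \<open>n\<close> lets one directed index set control both the finite
    subfamily and the size of the defects, also when \<open>\<F>\<close> itself is finite.\<close>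
  define I where "I = finite_subsets_at_top (\<F> \<times> (UNIV :: nat set))"
  have "\<exists>y\<in>C. \<forall>(T, n)\<in>X. lp_norm p (\<lambda>k. T y k - y k) \<le> 1 / real (Suc n)"
    if X: "finite X" "X \<subseteq> \<F> \<times> UNIV" for X
  proof -
    have fS: "finite (fst ` X)" "fst ` X \<subseteq> \<F>" using X by auto
    define N where "N = Max (insert 0 (snd ` X))"
    have N: "n \<le> N" if "(T, n) \<in> X" for T n
      unfolding N_def using X(1) that by (intro Max_ge) force+
    have "\<exists>y\<in>C. \<forall>T\<in>fst ` X. lp_norm p (\<lambda>k. T y k - y k) \<le> 1 / real (Suc N)"
    proof (rule approximate_common_fixed_point[OF p C])
      fix T U x assume "T \<in> fst ` X" "U \<in> fst ` X" "x \<in> C"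
      then show "T (U x) = U (T x)" using assms(5) fS(2) C(1) unfolding lp_commuting_def by blast
    qed (use fS inv assms(3,4) in \<open>auto simp: C_def intro: seq_hull.comb\<close>)
    then obtain y where y: "y \<in> C" "\<And>T. T \<in> fst ` X \<Longrightarrow> lp_norm p (\<lambda>k. T y k - y k) \<le> 1 / real (Suc N)"
      by blast
    have "lp_norm p (\<lambda>k. T y k - y k) \<le> 1 / real (Suc n)" if "(T, n) \<in> X" for T n
    proof -
      have "lp_norm p (\<lambda>k. T y k - y k) \<le> 1 / real (Suc N)" using that by (intro y(2)) force
      also have "\<dots> \<le> 1 / real (Suc n)" using N[OF that] by (simp add: frac_le)
      finally show ?thesis .
    qed
    with y(1) show ?thesis by blast
  qed
  then have "\<forall>X. \<exists>y. finite X \<and> X \<subseteq> \<F> \<times> UNIV \<longrightarrow>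
      y \<in> C \<and> (\<forall>(T, n)\<in>X. lp_norm p (\<lambda>k. T y k - y k) \<le> 1 / real (Suc n))"
    by blast
  then obtain Y where "\<forall>X. finite X \<and> X \<subseteq> \<F> \<times> UNIV \<longrightarrow>
      Y X \<in> C \<and> (\<forall>(T, n)\<in>X. lp_norm p (\<lambda>k. T (Y X) k - Y X k) \<le> 1 / real (Suc n))"
    unfolding choice_iff ..
  then have Y: "\<And>X. finite X \<Longrightarrow> X \<subseteq> \<F> \<times> UNIV \<Longrightarrow> Y X \<in> C"
    "\<And>X T n. finite X \<Longrightarrow> X \<subseteq> \<F> \<times> UNIV \<Longrightarrow> (T, n) \<in> X \<Longrightarrow>
      lp_norm p (\<lambda>k. T (Y X) k - Y X k) \<le> 1 / real (Suc n)"
    by blast+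
  define F where "F = filtermap Y I"
  have F: "F \<noteq> bot" by (simp add: F_def I_def filtermap_bot_iff)
  have FC: "\<forall>\<^sub>F y in F. y \<in> C"
    unfolding F_def I_def eventually_filtermap by (intro eventually_finite_subsets_at_top_weakI Y)
  have Fy: "\<forall>\<^sub>F y in F. y \<in> lp p \<and> lp_norm p y \<le> M"
    using FC by eventually_elim (use C in auto)
  have Ffix: "((\<lambda>y. lp_norm p (\<lambda>k. T y k - y k)) \<longlongrightarrow> 0) F" if T: "T \<in> \<F>" for T
  proof (rule tendstoI)
    fix e :: real assume "0 < e"
    then obtain n where n: "1 / real (Suc n) < e" using nat_approx_posE by blast
    have "\<forall>\<^sub>F X in I. lp_norm p (\<lambda>k. T (Y X) k - Y X k) < e"
      unfolding I_def eventually_finite_subsets_at_top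
      by (intro exI[of _ "{(T, n)}"]) (use T n Y(2)[of _ T n] in fastforce)
    then show "\<forall>\<^sub>F y in F. dist (lp_norm p (\<lambda>k. T y k - y k)) 0 < e"
      by (simp add: F_def eventually_filtermap lp_norm_nonneg)
  qed
  have bd: "\<forall>\<^sub>F y in F. \<forall>k. \<bar>y k\<bar> \<le> M"
    using Fy by eventually_elim (use lp_abs_le_norm[OF p] order_trans in blast)
  obtain G x where G: "G \<noteq> bot" "G \<le> F" "\<And>k. ((\<lambda>y. y k) \<longlongrightarrow> x k) G"
    by (rule bounded_filter_pointwise_cluster[OF F bd]) (rule that)
  have Gy: "\<forall>\<^sub>F y in G. y \<in> lp p \<and> lp_norm p y \<le> M" using Fy G(2) by (rule filter_leD[rotated])
  have "T x = x" if "T \<in> \<F>" for T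
    by (rule pointwise_limit_is_fixed[OF p G(1) assms(2)[OF that] assms(4)[OF that] Gy G(3)
      tendsto_mono[OF G(2) Ffix[OF that]]])
  moreover have "x \<in> lp p" by (rule lp_fatou[OF p G(1) Gy G(3)])
  ultimately show ?thesis by blast
qed

end
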